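(* Given a window $W=\{t_1,\dots,t_{|W|}\}$ of $|W|$ items, each carrying one value of a protected attribute with $\ell$ values $p_1,\dots,p_\ell$, the forward sketch construction algorithm FSketch (defined in the context) takes $\mathcal{O}(|W|\times \ell)$ time to run and takes $\mathcal{O}(|W|\times \ell)$ space.
   Context: The forward sketch of $W$ is a list $S$ of $|W|$ vectors of length $\ell-1$, where $S[i][j]$ ($1\le i\le |W|$, $1\le j\le \ell-1$) is the number of items among $t_1,\dots,t_i$ whose protected attribute value is $p_j$. Algorithm FSketch: initialize all vectors $S[1],\dots,S[|W|]$ to zero. For $i=1,\dots,|W|$: if $i>1$, copy $S[i]\leftarrow S[i-1]$; let $p$ be the protected attribute value of $t_i$; scan $j=1,\dots,\ell-1$, and if $p=p_j$ set $S[i][j]\leftarrow S[i][j]+1$ and leave the scan (if $p=p_\ell$, no update is made). Return $S$. Time is counted in elementary operations (arithmetic on, comparison of, and copying of single numbers/values cost $O(1)$ each); space is counted in numbers stored. *)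

theory Defs
  imports Complex_Main "HOL-Library.Landau_Symbols"
begin

section \<open>A small imperative language with a unit-cost semantics\<close>

text \<open>
  The algorithm is written as a program over a memory whose cells hold single numbers or single
  attribute values. All of its loops are for-loops, whose bounds are evaluated once on entry, so
  the semantics is a total function.
\<close>

datatype 'v cell = Num nat | Att 'v

text \<open>\<open>(x, [])\<close> is the scalar \<open>x\<close>, \<open>(x, [i])\<close> is \<open>x[i]\<close> and \<open>(x, [i, j])\<close> is \<open>x[i][j]\<close>.\<close>

type_synonym loc = "string \<times> nat list"
type_synonym 'v mem = "loc \<rightharpoonup> 'v cell"

datatype exp = Const nat | Read string "exp list" | Plus exp exp | Minus exp exp

datatype test = Eq exp exp | Less exp exp

datatype com =
    Skip
  | Assign string "exp list" exp
  | Seq com com  (infixr \<open>;;\<close> 60)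
  | If test com com
  | For string exp exp com  \<comment> \<open>the upper bound is inclusive\<close>
  | Break  \<comment> \<open>leaves the innermost enclosing for-loop\<close>

primrec num :: "'v cell \<Rightarrow> nat" where
  "num (Num n) = n"
| "num (Att v) = 0"

text \<open>
  An unset cell reads as \<open>0\<close>, and an attribute value used as a number counts as \<open>0\<close>; neither
  occurs in the program below.
\<close>

primrec eval :: "'v mem \<Rightarrow> exp \<Rightarrow> 'v cell" where
  "eval m (Const n) = Num n"
| "eval m (Read x es) =
     (case m (x, map (\<lambda>e. num (eval m e)) es) of None \<Rightarrow> Num 0 | Some c \<Rightarrow> c)"
| "eval m (Plus a b) = Num (num (eval m a) + num (eval m b))"
| "eval m (Minus a b) = Num (num (eval m a) - num (eval m b))"

text \<open>Every constant, memory access and arithmetic operation is charged one unit.\<close>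

primrec exp_cost :: "exp \<Rightarrow> nat" where
  "exp_cost (Const n) = 1"
| "exp_cost (Read x es) = 1 + sum_list (map exp_cost es)"
| "exp_cost (Plus a b) = 1 + exp_cost a + exp_cost b"
| "exp_cost (Minus a b) = 1 + exp_cost a + exp_cost b"

primrec holds :: "'v mem \<Rightarrow> test \<Rightarrow> bool" where
  "holds m (Eq a b) \<longleftrightarrow> eval m a = eval m b"
| "holds m (Less a b) \<longleftrightarrow> num (eval m a) < num (eval m b)"

primrec test_cost :: "test \<Rightarrow> nat" where
  "test_cost (Eq a b) = 1 + exp_cost a + exp_cost b"
| "test_cost (Less a b) = 1 + exp_cost a + exp_cost b"

text \<open>
  A result consists of a flag (is a \<open>Break\<close> pending?), the number of elementary operations
  performed, and the final memory. In a loop, each iteration entered is charged two units for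
  comparing the loop variable with the bound and updating it, and normal exit is charged one unit
  for the failing comparison.
\<close>

type_synonym 'v result = "bool \<times> nat \<times> 'v mem"

primrec iterate :: "(nat \<Rightarrow> 'v mem \<Rightarrow> 'v result) \<Rightarrow> nat list \<Rightarrow> 'v mem \<Rightarrow> nat \<times> 'v mem" where
  "iterate f [] m = (1, m)"
| "iterate f (k # ks) m =
     (let (broke, t, m') = f k m
      in if broke then (t + 2, m')
         else let (t', m'') = iterate f ks m' in (t + 2 + t', m''))"

primrec exec :: "com \<Rightarrow> 'v mem \<Rightarrow> 'v result" where
  "exec Skip m = (False, 1, m)"
| "exec (Assign x es e) m =
     (False, 1 + sum_list (map exp_cost es) + exp_cost e,
      m((x, map (\<lambda>e'. num (eval m e')) es) \<mapsto> eval m e))"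
| "exec (c ;; d) m =
     (let (broke, t, m') = exec c m
      in if broke then (True, t, m')
         else let (broke', t', m'') = exec d m' in (broke', t + t', m''))"
| "exec (If b c d) m =
     (let (broke, t, m') = (if holds m b then exec c m else exec d m)
      in (broke, test_cost b + t, m'))"
| "exec (For x lo hi c) m =
     (let (t, m') = iterate (\<lambda>k m. exec c (m((x, []) \<mapsto> Num k)))
                      [num (eval m lo)..<Suc (num (eval m hi))] m
      in (False, exp_cost lo + exp_cost hi + t, m'))"
| "exec Break m = (True, 1, m)"

definition run_time :: "com \<Rightarrow> 'v mem \<Rightarrow> nat" where
  "run_time c m = fst (snd (exec c m))"

definition final_mem :: "com \<Rightarrow> 'v mem \<Rightarrow> 'v mem" where
  "final_mem c m = snd (snd (exec c m))"

text \<open>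
  Cells are never freed (lemma \<open>exec_dom_mono\<close> below), so the number of cells in use at the end
  of a run is also the maximum over the run. It includes the cells occupied by the input.
\<close>

definition run_space :: "com \<Rightarrow> 'v mem \<Rightarrow> nat" where
  "run_space c m = card (dom (final_mem c m))"

lemma iterate_dom_mono:
  assumes "\<And>k m. dom m \<subseteq> dom (snd (snd (f k m)))"
  shows "dom m \<subseteq> dom (snd (iterate f ks m))"
proof (induction ks arbitrary: m)
  case (Cons k ks)
  obtain b t m' where r: "f k m = (b, t, m')" by (cases "f k m")
  have "dom m \<subseteq> dom m'" using assms[of m k] r by simp
  also have "\<dots> \<subseteq> dom (snd (iterate f ks m'))" by (rule Cons.IH)
  finally show ?case using r \<open>dom m \<subseteq> dom m'\<close> by (simp add: case_prod_beta)
qed simp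

lemma exec_dom_mono: "dom m \<subseteq> dom (snd (snd (exec c m)))"
proof (induction c arbitrary: m)
  case (Seq c d)
  obtain b t m' where r: "exec c m = (b, t, m')" by (cases "exec c m")
  have "dom m \<subseteq> dom m'" using Seq.IH(1)[of m] r by simp
  also have "\<dots> \<subseteq> dom (snd (snd (exec d m')))" by (rule Seq.IH(2))
  finally show ?case using r \<open>dom m \<subseteq> dom m'\<close> by (simp add: case_prod_beta)
next
  case (If b c d)
  from If.IH(1)[of m] If.IH(2)[of m] show ?case by (auto split: prod.splits)
next
  case (For x lo hi c)
  have "dom m \<subseteq> dom (snd (snd (exec c (m((x, []) \<mapsto> Num k)))))" for m :: "'a mem" and k
    by (rule subset_trans[OF _ For.IH])
      (simp only: dom_fun_upd option.distinct if_False subset_insertI)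
  from iterate_dom_mono[OF this] show ?case
    by (simp add: case_prod_beta)
qed auto

lemma iterate_finite_dom:
  assumes "\<And>k m. finite (dom m) \<Longrightarrow> finite (dom (snd (snd (f k m))))" "finite (dom m)"
  shows "finite (dom (snd (iterate f ks m)))"
  using assms(2)
proof (induction ks arbitrary: m)
  case (Cons k ks)
  obtain b t m' where r: "f k m = (b, t, m')" by (cases "f k m")
  have "finite (dom m')" using assms(1)[OF Cons.prems, of k] r by simp
  with r Cons.IH[of m'] show ?case by (auto split: prod.splits)
qed simp

lemma exec_finite_dom: "finite (dom m) \<Longrightarrow> finite (dom (snd (snd (exec c m))))"
proof (induction c arbitrary: m)
  case (Seq c d)
  obtain b t m' where r: "exec c m = (b, t, m')" by (cases "exec c m")
  with Seq.IH(1)[OF Seq.prems] Seq.IH(2)[of m'] show ?case by (auto split: prod.splits)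
next
  case (If b c d)
  from If.IH(1)[OF If.prems] If.IH(2)[OF If.prems] show ?case by (auto split: prod.splits)
next
  case (For x lo hi c)
  have "finite (dom (snd (snd (exec c (m((x, []) \<mapsto> Num k))))))"
    if "finite (dom m)" for m :: "'a mem" and k
    by (rule For.IH) (simp only: dom_fun_upd that finite_insert option.distinct if_False)
  from iterate_finite_dom[OF this For.prems] show ?case
    by (simp add: case_prod_beta)
qed auto


section \<open>The forward sketch construction\<close>

text \<open>
  Input cells: \<open>n\<close> holds $|W|$, \<open>l\<close> holds $\ell$, \<open>P[j]\<close> holds $p_j$, and \<open>T[i]\<close> holds the
  protected attribute value of $t_i$, the only part of an item that the algorithm inspects.
  The returned list of vectors is the array \<open>S\<close>.
\<close>

abbreviation Var :: "string \<Rightarrow> exp" where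
  "Var x \<equiv> Read x []"

definition FSketch :: com where
  "FSketch =
     For ''i'' (Const 1) (Var ''n'')
       (For ''j'' (Const 1) (Minus (Var ''l'') (Const 1))
         (Assign ''S'' [Var ''i'', Var ''j''] (Const 0))) ;;
     For ''i'' (Const 1) (Var ''n'')
       (If (Less (Const 1) (Var ''i''))
          (For ''j'' (Const 1) (Minus (Var ''l'') (Const 1))
            (Assign ''S'' [Var ''i'', Var ''j'']
              (Read ''S'' [Minus (Var ''i'') (Const 1), Var ''j''])))
          Skip ;;
        Assign ''p'' [] (Read ''T'' [Var ''i'']) ;;
        For ''j'' (Const 1) (Minus (Var ''l'') (Const 1))
          (If (Eq (Var ''p'') (Read ''P'' [Var ''j'']))
             (Assign ''S'' [Var ''i'', Var ''j'']
                (Plus (Read ''S'' [Var ''i'', Var ''j'']) (Const 1)) ;;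
              Break)
             Skip))"

text \<open>
  An input consists of the protected attribute \<open>A\<close>, the list \<open>ps\<close> of its values
  $p_1, \dots, p_\ell$ and the list \<open>W\<close> of items $t_1, \dots, t_{|W|}$. Lists are indexed from
  \<open>0\<close>, the arrays from \<open>1\<close>.
\<close>

definition input_mem :: "('a \<Rightarrow> 'v) \<Rightarrow> 'v list \<Rightarrow> 'a list \<Rightarrow> 'v mem" where
  "input_mem A ps W = map_of
     ([((''n'', []), Num (length W)), ((''l'', []), Num (length ps))]
      @ map (\<lambda>j. ((''P'', [j]), Att (ps ! (j - 1)))) [1..<Suc (length ps)]
      @ map (\<lambda>i. ((''T'', [i]), Att (A (W ! (i - 1))))) [1..<Suc (length W)])"

definition FSketch_time :: "('a \<Rightarrow> 'v) \<Rightarrow> 'v list \<Rightarrow> 'a list \<Rightarrow> nat" where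
  "FSketch_time A ps W = run_time FSketch (input_mem A ps W)"

definition FSketch_space :: "('a \<Rightarrow> 'v) \<Rightarrow> 'v list \<Rightarrow> 'a list \<Rightarrow> nat" where
  "FSketch_space A ps W = run_space FSketch (input_mem A ps W)"

text \<open>
  Windows are nonempty, hence $|W| \ge 1$ and $\ell \ge 1$. On the principal filter of this set,
  membership in \<open>O\<close> means that one constant works for all windows and all values of $\ell$
  simultaneously.
\<close>

definition instances :: "(('a \<Rightarrow> 'v) \<times> 'v list \<times> 'a list) set" where
  "instances = {(A, ps, W). distinct ps \<and> W \<noteq> [] \<and> (\<forall>t\<in>set W. A t \<in> set ps)}"

end

theory Submission
  imports Defs
begin

text \<open>
  A Hoare-style calculus charges every command a worst-case cost relative to an invariant. For
  \<open>FSketch\<close> the invariant says that \<open>n\<close> and \<open>l\<close> keep their input values and that only cells from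
  a fixed set of size $O(|W| \cdot \ell)$ are ever used. So both for-loops over \<open>i\<close> make $|W|$
  iterations, each of cost $O(\ell)$, and the same invariant bounds the space.
\<close>

definition runs_within :: "('v mem \<Rightarrow> bool) \<Rightarrow> com \<Rightarrow> nat \<Rightarrow> bool" where
  "runs_within I c t \<longleftrightarrow> (\<forall>m. I m \<longrightarrow> run_time c m \<le> t \<and> I (final_mem c m))"

lemma runs_within_mono: "runs_within I c t \<Longrightarrow> t \<le> t' \<Longrightarrow> runs_within I c t'"
  unfolding runs_within_def by (meson le_trans)

lemma runs_within_Skip: "runs_within I Skip 1"
  by (simp add: runs_within_def run_time_def final_mem_def)

lemma runs_within_Break: "runs_within I Break 1"
  by (simp add: runs_within_def run_time_def final_mem_def)

lemma runs_within_Assign: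
  assumes "\<And>m. I m \<Longrightarrow> I (m((x, map (\<lambda>e'. num (eval m e')) es) \<mapsto> eval m e))"
  shows "runs_within I (Assign x es e) (1 + sum_list (map exp_cost es) + exp_cost e)"
  using assms by (simp add: runs_within_def run_time_def final_mem_def)

text \<open>If \<open>c\<close> ends with a pending break, \<open>d\<close> is not run: the cost is
  then at most \<open>s\<close>, and the memory left by \<open>c\<close> already satisfies
  \<open>I\<close>.\<close>

lemma runs_within_Seq:
  assumes "runs_within I c s" "runs_within I d t"
  shows "runs_within I (c ;; d) (s + t)"
  unfolding runs_within_def
proof (intro allI impI)
  fix m assume "I m"
  obtain b r m' where c: "exec c m = (b, r, m')" by (cases "exec c m")
  obtain b' r' m'' where d: "exec d m' = (b', r', m'')" by (cases "exec d m'")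
  have "r \<le> s" "I m'"
    using assms(1) \<open>I m\<close> c by (auto simp: runs_within_def run_time_def final_mem_def)
  moreover from \<open>I m'\<close> have "r' \<le> t" "I m''"
    using assms(2) d by (auto simp: runs_within_def run_time_def final_mem_def)
  ultimately show "run_time (c ;; d) m \<le> s + t \<and> I (final_mem (c ;; d) m)"
    using c d by (simp add: run_time_def final_mem_def)
qed

lemma runs_within_If:
  assumes "runs_within I c s" "runs_within I d t"
  shows "runs_within I (If b c d) (test_cost b + max s t)"
  using assms
  by (auto simp: runs_within_def run_time_def final_mem_def case_prod_beta le_max_iff_disj)

text \<open>Each entered iteration costs at most \<open>t + 2\<close> and normal exit costs 1. A
  break only cuts the list short, so the bound for the full list covers it.\<close>

lemma iterate_within:
  assumes "\<And>k m. k \<in> set ks \<Longrightarrow> I m \<Longrightarrow> fst (snd (f k m)) \<le> t \<and> I (snd (snd (f k m)))"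
    and "I m"
  shows "fst (iterate f ks m) \<le> length ks * (t + 2) + 1 \<and> I (snd (iterate f ks m))"
  using assms
proof (induction ks arbitrary: m)
  case (Cons k ks)
  obtain b r m' where r: "f k m = (b, r, m')" by (cases "f k m")
  have "r \<le> t" "I m'" using Cons.prems(1)[of k m] Cons.prems(2) r by auto
  moreover have "fst (iterate f ks m') \<le> length ks * (t + 2) + 1 \<and> I (snd (iterate f ks m'))"
    using Cons.prems(1) \<open>I m'\<close> by (intro Cons.IH) auto
  ultimately show ?case using r by (auto simp: case_prod_beta)
qed simp

text \<open>The invariant \<open>J k\<close> of the body may mention the current value \<open>k\<close> of the loop variable.\<close>

lemma runs_within_For:
  assumes "\<And>m. I m \<Longrightarrow> num (eval m hi) = h"
    and enter: "\<And>k m. 1 \<le> k \<Longrightarrow> k \<le> h \<Longrightarrow> I m \<Longrightarrow> J k (m((x, []) \<mapsto> Num k))"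
    and leave: "\<And>k m. 1 \<le> k \<Longrightarrow> k \<le> h \<Longrightarrow> J k m \<Longrightarrow> I m"
    and body: "\<And>k. 1 \<le> k \<Longrightarrow> k \<le> h \<Longrightarrow> runs_within (J k) c t"
  shows "runs_within I (For x (Const 1) hi c) (2 + exp_cost hi + h * (t + 2))"
  unfolding runs_within_def
proof (intro allI impI)
  fix m assume "I m"
  let ?f = "\<lambda>k m. exec c (m((x, []) \<mapsto> Num k))"
  have "fst (snd (?f k m)) \<le> t \<and> I (snd (snd (?f k m)))"
    if "k \<in> set [1..<Suc h]" "I m" for k m
  proof -
    from that(1) have k: "1 \<le> k" "k \<le> h" by auto
    then show ?thesis
      using enter[OF k that(2)] leave[OF k] body[OF k]
      unfolding runs_within_def run_time_def final_mem_def by blast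
  qed
  \<comment> \<open>\<open>[1..<Suc h]\<close> has \<open>h\<close> entries. The summand 2 pays for
    the constant lower bound and for the failing comparison on exit.\<close>
  from iterate_within[of "[1..<Suc h]" I ?f, OF this \<open>I m\<close>]
  show "run_time (For x (Const 1) hi c) m \<le> 2 + exp_cost hi + h * (t + 2)
      \<and> I (final_mem (For x (Const 1) hi c) m)"
    using assms(1)[OF \<open>I m\<close>]
    by (simp add: run_time_def final_mem_def case_prod_beta del: upt_Suc)
qed

text \<open>An overapproximation: \<open>S\<close> gets \<open>L\<close> columns instead of
  \<open>L - 1\<close>, which keeps its size a plain product.\<close>

definition sketch_cells :: "nat \<Rightarrow> nat \<Rightarrow> loc set" where
  "sketch_cells N L =
     {(''n'', []), (''l'', []), (''i'', []), (''j'', []), (''p'', [])}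
     \<union> (\<lambda>j. (''P'', [j])) ` {1..L} \<union> (\<lambda>i. (''T'', [i])) ` {1..N}
     \<union> (\<lambda>(i, j). (''S'', [i, j])) ` ({1..N} \<times> {1..L})"

lemma sketch_cells_S:
  "1 \<le> i \<Longrightarrow> i \<le> N \<Longrightarrow> 1 \<le> j \<Longrightarrow> j \<le> L \<Longrightarrow> (''S'', [i, j]) \<in> sketch_cells N L"
  by (force simp: sketch_cells_def)

lemma finite_sketch_cells: "finite (sketch_cells N L)"
  by (simp add: sketch_cells_def)

lemma card_sketch_cells: "card (sketch_cells N L) \<le> 5 + L + N + N * L"
proof -
  have "card {(''n'', [] :: nat list), (''l'', []), (''i'', []), (''j'', []), (''p'', [])} = 5"
    by simp
  moreover have "card ((\<lambda>j. (''P'', [j])) ` {1..L}) \<le> L"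
    using card_image_le[of "{1..L}"] by simp
  moreover have "card ((\<lambda>i. (''T'', [i])) ` {1..N}) \<le> N"
    using card_image_le[of "{1..N}"] by simp
  moreover have "card ((\<lambda>(i, j). (''S'', [i, j])) ` ({1..N} \<times> {1..L})) \<le> N * L"
    using card_image_le[of "{1..N} \<times> {1..L}"] by (simp add: card_cartesian_product)
  ultimately show ?thesis
    unfolding sketch_cells_def by (intro order_trans[OF card_Un_le] add_mono) simp_all
qed

text \<open>The contents of \<open>S\<close>, \<open>P\<close> and \<open>T\<close> are left open:
  the cost bound takes the dearer branch of every test and full length for every scan, so it does
  not depend on the counts.\<close>

definition sketch_inv :: "nat \<Rightarrow> nat \<Rightarrow> 'v mem \<Rightarrow> bool" where
  "sketch_inv N L m \<longleftrightarrow>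
     m (''n'', []) = Some (Num N) \<and> m (''l'', []) = Some (Num L) \<and> dom m \<subseteq> sketch_cells N L"

lemma sketch_inv_upd:
  assumes "sketch_inv N L m" "x \<in> sketch_cells N L" "x \<noteq> (''n'', [])" "x \<noteq> (''l'', [])"
  shows "sketch_inv N L (m(x \<mapsto> c))"
  using assms by (auto simp: sketch_inv_def)

text \<open>The loop variables are tracked because the address of a write to \<open>S[i][j]\<close>
  is computed from them and has to lie in \<open>sketch_cells\<close>.\<close>

abbreviation row_inv :: "nat \<Rightarrow> nat \<Rightarrow> nat \<Rightarrow> 'v mem \<Rightarrow> bool" where
  "row_inv N L i m \<equiv> sketch_inv N L m \<and> m (''i'', []) = Some (Num i)"

abbreviation entry_inv :: "nat \<Rightarrow> nat \<Rightarrow> nat \<Rightarrow> nat \<Rightarrow> 'v mem \<Rightarrow> bool" where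
  "entry_inv N L i j m \<equiv> row_inv N L i m \<and> m (''j'', []) = Some (Num j)"

lemma runs_within_For_i:
  assumes "\<And>i. 1 \<le> i \<Longrightarrow> i \<le> N \<Longrightarrow> runs_within (row_inv N L i :: 'v mem \<Rightarrow> bool) c t"
  shows "runs_within (sketch_inv N L :: 'v mem \<Rightarrow> bool)
      (For ''i'' (Const 1) (Var ''n'') c) (3 + N * (t + 2))"
proof -
  have "runs_within (sketch_inv N L :: 'v mem \<Rightarrow> bool)
      (For ''i'' (Const 1) (Var ''n'') c)
      (2 + exp_cost (Var ''n'') + N * (t + 2))"
  proof (rule runs_within_For[where J = "row_inv N L"])
    show "runs_within (row_inv N L k :: 'v mem \<Rightarrow> bool) c t" if "1 \<le> k" "k \<le> N" for k
      by (rule assms) (use that in auto)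
  \<comment> \<open>\<open>sketch_inv\<close> stays folded while \<open>sketch_inv_upd\<close>
    handles the write to \<open>i\<close>; it is unfolded last, to read the loop bound off cell
    \<open>n\<close>.\<close>
  qed (auto simp: sketch_inv_upd sketch_cells_def, simp add: sketch_inv_def)
  then show ?thesis by simp
qed

text \<open>The 5 is the loop overhead 2 plus the cost 3 of evaluating \<open>l - 1\<close>.
  \<open>Minus\<close> truncates as subtraction on \<open>nat\<close> does, so \<open>L - 1\<close>
  is the exact length of the range even for \<open>L = 0\<close>.\<close>

lemma runs_within_For_j:
  assumes "\<And>j. 1 \<le> j \<Longrightarrow> j \<le> L \<Longrightarrow> runs_within (entry_inv N L i j :: 'v mem \<Rightarrow> bool) c t"
  shows "runs_within (row_inv N L i :: 'v mem \<Rightarrow> bool)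
      (For ''j'' (Const 1) (Minus (Var ''l'') (Const 1)) c)
      (5 + (L - 1) * (t + 2))"
proof -
  have "runs_within (row_inv N L i :: 'v mem \<Rightarrow> bool)
      (For ''j'' (Const 1) (Minus (Var ''l'') (Const 1)) c)
      (2 + exp_cost (Minus (Var ''l'') (Const 1)) + (L - 1) * (t + 2))"
  proof (rule runs_within_For[where J = "entry_inv N L i"])
    show "runs_within (entry_inv N L i k :: 'v mem \<Rightarrow> bool) c t" if "1 \<le> k" "k \<le> L - 1" for k
      by (rule assms) (use that in auto)
  qed (auto simp: sketch_inv_upd sketch_cells_def, simp add: sketch_inv_def)
  then show ?thesis by simp
qed

lemma runs_within_Assign_S:
  assumes "1 \<le> i" "i \<le> N" "1 \<le> j" "j \<le> L"
  shows "runs_within (entry_inv N L i j) (Assign ''S'' [Var ''i'', Var ''j''] e) (3 + exp_cost e)"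
proof -
  have "runs_within (entry_inv N L i j) (Assign ''S'' [Var ''i'', Var ''j''] e)
      (1 + sum_list (map exp_cost [Var ''i'', Var ''j'']) + exp_cost e)"
    using assms by (intro runs_within_Assign) (auto simp: sketch_inv_upd sketch_cells_S)
  then show ?thesis by (rule runs_within_mono) simp
qed

lemma runs_within_FSketch:
  "runs_within (sketch_inv N L) FSketch (6 + N * (25 + 31 * (L - 1)))"
proof -
  let ?S = "\<lambda>e. Assign ''S'' [Var ''i'', Var ''j''] e"
  let ?For = "For ''j'' (Const 1) (Minus (Var ''l'') (Const 1))"
  let ?copy = "If (Less (Const 1) (Var ''i''))
      (?For (?S (Read ''S'' [Minus (Var ''i'') (Const 1), Var ''j'']))) Skip"
  let ?read = "Assign ''p'' [] (Read ''T'' [Var ''i''])"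
  let ?count = "?For (If (Eq (Var ''p'') (Read ''P'' [Var ''j'']))
      (?S (Plus (Read ''S'' [Var ''i'', Var ''j'']) (Const 1)) ;; Break) Skip)"
  \<comment> \<open>6 = 4 for the assignment + 2 for the loop step.\<close>
  have zero: "runs_within (row_inv N L i) (?For (?S (Const 0))) (5 + (L - 1) * 6)"
    if "1 \<le> i" "i \<le> N" for i
    by (rule runs_within_mono, rule runs_within_For_j, rule runs_within_Assign_S)
      (use that in auto)
  \<comment> \<open>8 = 3 for the test + 5 for the loop; 10 = 8 for the assignment + 2. Reads
    allocate no cell, so the index \<open>i - 1\<close> needs no range check.\<close>
  have copy: "runs_within (row_inv N L i) ?copy (8 + (L - 1) * 10)"
    if "1 \<le> i" "i \<le> N" for i
    by (rule runs_within_mono, rule runs_within_If, rule runs_within_For_j,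
        rule runs_within_Assign_S, (use that in auto)[4], rule runs_within_Skip) simp
  have read: "runs_within (row_inv N L i) ?read 3" for i
    by (rule runs_within_mono, rule runs_within_Assign)
      (auto simp: sketch_inv_upd sketch_cells_def)
  \<comment> \<open>15 = 4 for the test + 8 for the increment + 1 for \<open>Break\<close> + 2, as
    if every iteration took the first branch and none left the scan.\<close>
  have count: "runs_within (row_inv N L i) ?count (5 + (L - 1) * 15)"
    if "1 \<le> i" "i \<le> N" for i
    by (rule runs_within_mono, rule runs_within_For_j, rule runs_within_If,
        rule runs_within_Seq, rule runs_within_Assign_S, (use that in auto)[4],
        rule runs_within_Break, rule runs_within_Skip) simp
  have row: "runs_within (row_inv N L i) (?copy ;; ?read ;; ?count) (16 + (L - 1) * 25)"
    if "1 \<le> i" "i \<le> N" for i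
    by (rule runs_within_mono, rule runs_within_Seq[OF copy[OF that]],
        rule runs_within_Seq[OF read count[OF that]]) simp
  \<comment> \<open>The two loops over \<open>i\<close> cost
    \<open>3 + N * (7 + 6 * (L - 1))\<close> and \<open>3 + N * (18 + 25 * (L - 1))\<close>.\<close>
  show ?thesis
    unfolding FSketch_def
    by (rule runs_within_mono, rule runs_within_Seq, rule runs_within_For_i, rule zero,
        assumption+, rule runs_within_For_i, rule row, assumption+)
      (simp add: algebra_simps)
qed

lemma sketch_inv_input_mem: "sketch_inv (length W) (length ps) (input_mem A ps W)"
  by (auto simp: sketch_inv_def input_mem_def sketch_cells_def dom_map_of_conv_image_fst
      simp del: upt_Suc)

lemma FSketch_time_le:
  "FSketch_time A ps W \<le> 6 + length W * (25 + 31 * (length ps - 1))"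
  using runs_within_FSketch sketch_inv_input_mem
  unfolding FSketch_time_def runs_within_def by blast

lemma FSketch_space_le:
  "FSketch_space A ps W \<le> 5 + length ps + length W + length W * length ps"
proof -
  have "sketch_inv (length W) (length ps) (final_mem FSketch (input_mem A ps W))"
    using runs_within_FSketch sketch_inv_input_mem unfolding runs_within_def by blast
  then have "FSketch_space A ps W \<le> card (sketch_cells (length W) (length ps))"
    unfolding FSketch_space_def run_space_def sketch_inv_def
    by (intro card_mono finite_sketch_cells) blast
  then show ?thesis using card_sketch_cells by (rule order_trans)
qed

text \<open>The window has a first item, whose attribute value lies in \<open>set ps\<close>; hence
  \<open>ps\<close> is nonempty too.\<close>

lemma instances_nonempty:
  assumes "(A, ps, W) \<in> instances"
  shows "length W \<ge> 1" "length ps \<ge> 1"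
  using assms by (cases W; cases ps; auto simp: instances_def)+

text \<open>On a principal filter, "eventually" means everywhere on the set, so one constant
  \<open>C\<close> has to serve all instances, with no threshold on the sizes.\<close>

lemma bigo_instancesI:
  fixes f :: "('a \<Rightarrow> 'v) \<Rightarrow> 'v list \<Rightarrow> 'a list \<Rightarrow> nat"
  assumes "\<And>A ps W. length W \<ge> 1 \<Longrightarrow> length ps \<ge> 1 \<Longrightarrow> f A ps W \<le> C * (length W * length ps)"
  shows "(\<lambda>(A, ps, W). real (f A ps W))
           \<in> O[principal instances](\<lambda>(A, ps, W). real (length W) * real (length ps))"
proof (rule bigoI[where c = "real C"], unfold eventually_principal, clarify)
  fix A :: "'a \<Rightarrow> 'v" and ps W
  assume "(A, ps, W) \<in> instances"
  then have "f A ps W \<le> C * (length W * length ps)"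
    by (intro assms instances_nonempty)
  then have "real (f A ps W) \<le> real (C * (length W * length ps))"
    by (rule of_nat_mono)
  then show "norm (real (f A ps W)) \<le> real C * norm (real (length W) * real (length ps))"
    by simp
qed

theorem theorem3p2:
  "(\<lambda>(A :: 'a \<Rightarrow> 'v, ps, W). real (FSketch_time A ps W))
           \<in> O[principal instances](\<lambda>(A, ps, W). real (length W) * real (length ps))
       \<and> (\<lambda>(A :: 'a \<Rightarrow> 'v, ps, W). real (FSketch_space A ps W))
           \<in> O[principal instances](\<lambda>(A, ps, W). real (length W) * real (length ps))"
proof (intro conjI bigo_instancesI)
  fix A :: "'a \<Rightarrow> 'v" and ps :: "'v list" and W :: "'a list"
  assume N: "length W \<ge> 1" and L: "length ps \<ge> 1"
  \<comment> \<open>Since both factors are at least 1, the product absorbs all lower-order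
    terms.\<close>
  have le: "1 \<le> length W * length ps" "length W \<le> length W * length ps"
    "length ps \<le> length W * length ps"
    using N L by auto
  have "length W * (25 + 31 * (length ps - 1)) \<le> length W * (31 * length ps)"
    using L by (intro mult_le_mono2) linarith
  also have "\<dots> = 31 * (length W * length ps)"
    by simp
  \<comment> \<open>37 = 31 + 6, the additive 6 being absorbed by \<open>le(1)\<close>.\<close>
  finally show "FSketch_time A ps W \<le> 37 * (length W * length ps)"
    using FSketch_time_le[of A ps W] le(1) by linarith
  \<comment> \<open>8 = 5 + 1 + 1 + 1, one share for each summand of the space bound.\<close>
  show "FSketch_space A ps W \<le> 8 * (length W * length ps)"
    using FSketch_space_le[of A ps W] le by linarith
qed

end
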